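(* Let $n\ge 2$, let $K\subset\mathbb{R}^n$ be an $o$-symmetric convex body with non-empty interior, let $\Lambda\subset\mathbb{R}^n$ be a lattice of rank $n$, and let $\Lambda_1\subsetneq\Lambda$ be a proper sublattice of rank $n$. Then for $1\le i\le n$, $$\lambda_i(K,\Lambda\setminus\Lambda_1)\le\frac{2^n\det\Lambda}{\lambda_1(K,\Lambda_1)^{n-1}\operatorname{vol}(K)}+\lambda_1(K,\Lambda)+\lambda_i(K,\Lambda).$$
   Context: An $o$-symmetric convex body is a compact convex set $K\subset\mathbb{R}^n$ with $K=-K$; $\operatorname{vol}$ is $n$-dimensional Lebesgue measure. A lattice $\Lambda\subset\mathbb{R}^n$ is a discrete additive subgroup (the $\mathbb{Z}$-span of $r$ linearly independent vectors, $r=\operatorname{rank}\Lambda\le n$); $\det\Lambda$ is the $r$-dimensional volume of a fundamental cell of $\Lambda$. For a set $X\subset\mathbb{R}^n$, $\dim X$ denotes here the dimension of its linear span (the maximal number of linearly independent points of $X$). The successive minima are $\lambda_i(K,\Lambda)=\min\{\lambda\ge 0:\dim(\lambda K\cap\Lambda)\ge i\}$ for $1\le i\le\operatorname{rank}\Lambda$. For a sublattice $\Lambda_1\subsetneq\Lambda$ the $i$-th restricted successive minimum is $\lambda_i(K,\Lambda\setminus\Lambda_1)=\min\{\lambda\ge 0:\dim(\lambda K\cap(\Lambda\setminus\Lambda_1))\ge i\}$ for $1\le i\le\operatorname{rank}\Lambda$. *)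

theory Defs
  imports "HOL-Analysis.Analysis"
begin

definition o_symmetric_convex_body :: "'a::euclidean_space set \<Rightarrow> bool" where
  "o_symmetric_convex_body K \<longleftrightarrow> compact K \<and> convex K \<and> K = uminus ` K"

definition int_span :: "'a::euclidean_space set \<Rightarrow> 'a set" where
  "int_span B = {\<Sum>b\<in>B. of_int (c b) *\<^sub>R b | c :: 'a \<Rightarrow> int. True}"

definition lattice_basis :: "'a::euclidean_space set \<Rightarrow> 'a set \<Rightarrow> bool" where
  "lattice_basis L B \<longleftrightarrow> independent B \<and> L = int_span B"

definition lattice_of_rank :: "nat \<Rightarrow> 'a::euclidean_space set \<Rightarrow> bool" where
  "lattice_of_rank r L \<longleftrightarrow> (\<exists>B. lattice_basis L B \<and> card B = r)"

definition fundamental_cell :: "'a::euclidean_space set \<Rightarrow> 'a set" where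
  "fundamental_cell B = {\<Sum>b\<in>B. u b *\<^sub>R b | u :: 'a \<Rightarrow> real. \<forall>b\<in>B. 0 \<le> u b \<and> u b < 1}"

(* Meant for lattices of full rank only: the volume is taken in the ambient space, so this is 0
   for a lattice of smaller rank. The volume does not depend on the basis that SOME selects. *)
definition lattice_det :: "'a::euclidean_space set \<Rightarrow> real" where
  "lattice_det L = measure lebesgue (fundamental_cell (SOME B. lattice_basis L B))"

(* The set X is either a lattice or, for the restricted successive minima, the difference of a
   lattice and a sublattice. The constant dim of the library is the dimension of the linear span.
   LEAST renders a minimum, and is unspecified where none is attained. *)
definition successive_minimum :: "'a::euclidean_space set \<Rightarrow> 'a set \<Rightarrow> nat \<Rightarrow> real" where
  "successive_minimum K X i = (LEAST t. 0 \<le> t \<and> i \<le> dim ((\<lambda>x. t *\<^sub>R x) ` K \<inter> X))"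

end

theory Submission
  imports Defs
begin

text \<open>
  Let \<open>N\<close> be the norm with unit ball \<open>K\<close>, \<open>\<lambda>\<close> the length of a shortest nonzero vector of \<open>L1\<close>, and
  \<open>t\<close> the volume quotient of the theorem with \<open>\<lambda>\<close> in the denominator. A shortest vector \<open>a\<close> of
  \<open>L - L1\<close> satisfies \<open>N a \<le> t + \<lambda>\<close>: the segment from 0 to \<open>a\<close> is a geodesic modulo \<open>L1\<close>, so if
  \<open>N a\<close> were larger, the \<open>\<lfloor>t / \<lambda>\<rfloor> + 1\<close> open balls of radius \<open>\<lambda> / 2\<close> centred on it at spacing \<open>\<lambda>\<close>
  would be disjoint modulo \<open>L1\<close>, of total volume above \<open>det L\<close>, and Blichfeldt's principle would give
  a difference in \<open>L - L1\<close> shorter than \<open>a\<close>. A shortest nonzero vector of \<open>L\<close> either lies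
  outside \<open>L1\<close> or shows that \<open>\<lambda>\<close> is at most the first minimum of \<open>L\<close>. Finally, if \<open>b\<close> is in \<open>L1\<close>, then
  \<open>a + b\<close> is in \<open>L - L1\<close>, which transfers independent vectors from \<open>L\<close> to \<open>L - L1\<close>.
\<close>

section \<open>Integer spans and their discreteness\<close>

lemma int_span_memI: "(\<Sum>b\<in>B. of_int (c b) *\<^sub>R b) \<in> int_span B"
  unfolding int_span_def by blast

lemma int_span_diff: "x \<in> int_span B \<Longrightarrow> y \<in> int_span B \<Longrightarrow> x - y \<in> int_span B"
proof -
  assume "x \<in> int_span B" "y \<in> int_span B"
  then obtain c d :: "'a \<Rightarrow> int" where
    "x = (\<Sum>b\<in>B. of_int (c b) *\<^sub>R b)" "y = (\<Sum>b\<in>B. of_int (d b) *\<^sub>R b)"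
    unfolding int_span_def by blast
  then have "x - y = (\<Sum>b\<in>B. of_int (c b - d b) *\<^sub>R b)"
    by (simp add: scaleR_diff_left sum_subtractf)
  then show ?thesis by (simp only: int_span_memI)
qed

lemma zero_in_int_span: "0 \<in> int_span B"
  using int_span_memI[of "\<lambda>_. 0" B] by simp

lemma int_span_add: "x \<in> int_span B \<Longrightarrow> y \<in> int_span B \<Longrightarrow> x + y \<in> int_span B"
  using int_span_diff[of x B "0 - y"] int_span_diff[OF zero_in_int_span, of y B] by simp

lemma int_span_superset:
  assumes "finite B" shows "B \<subseteq> int_span B"
proof
  fix b assume b: "b \<in> B"
  have "(\<Sum>x\<in>B. of_int ((\<lambda>x. if x = b then 1 else 0) x) *\<^sub>R x) = (\<Sum>x\<in>B. if x = b then x else 0)"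
    by (intro sum.cong) auto
  also have "\<dots> = b" using assms b by simp
  finally show "b \<in> int_span B"
    using int_span_memI[of "\<lambda>x. if x = b then 1 else 0" B] by (simp only:)
qed

text \<open>Coordinate functionals are bounded on a bounded set, so the integer coefficients of the
  points in question range over a finite box.\<close>

lemma finite_int_span_Int_bounded:
  fixes B :: "'a::euclidean_space set"
  assumes B: "independent B" and S: "bounded S"
  shows "finite (int_span B \<inter> S)"
proof -
  have fin: "finite B" using B by (rule finiteI_independent)
  obtain R where R: "\<And>x. x \<in> S \<Longrightarrow> norm x \<le> R"
    using S by (auto simp: bounded_iff)
  have "\<exists>C. \<forall>c::'a \<Rightarrow> int. (\<Sum>a\<in>B. of_int (c a) *\<^sub>R a) \<in> S \<longrightarrow> \<bar>c b\<bar> \<le> C" if b: "b \<in> B" for b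
  proof -
    obtain g :: "'a \<Rightarrow> real" where g: "linear g" "\<And>x. x \<in> B \<Longrightarrow> g x = (if x = b then 1 else 0)"
      using linear_independent_extend[OF B, of "\<lambda>x. if x = b then 1 else 0"] by auto
    obtain k where k: "\<And>x. \<bar>g x\<bar> \<le> norm x * k" "k > 0"
      using bounded_linear.pos_bounded[OF linear_conv_bounded_linear[THEN iffD1, OF g(1)]] by auto
    have "\<bar>c b\<bar> \<le> \<lceil>R * k\<rceil>" if "(\<Sum>a\<in>B. of_int (c a) *\<^sub>R a) \<in> S" for c :: "'a \<Rightarrow> int"
    proof -
      let ?x = "\<Sum>a\<in>B. of_int (c a) *\<^sub>R a"
      have "g ?x = (\<Sum>a\<in>B. of_int (c a) * (if a = b then 1 else 0))"
        using g by (simp add: linear_sum linear_scale)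
      also have "\<dots> = of_int (c b)" using fin b by (simp add: if_distrib cong: if_cong)
      finally have "\<bar>of_int (c b)\<bar> \<le> norm ?x * k" using k(1)[of ?x] by simp
      also have "\<dots> \<le> R * k" using R[OF that] k(2) by (simp add: mult_right_mono)
      finally show ?thesis by linarith
    qed
    then show ?thesis by blast
  qed
  then obtain C where C: "\<And>b c. b \<in> B \<Longrightarrow> (\<Sum>a\<in>B. of_int (c a) *\<^sub>R a) \<in> S \<Longrightarrow> \<bar>c b\<bar> \<le> (C b :: int)"
    by metis
  have "int_span B \<inter> S \<subseteq> (\<lambda>c. \<Sum>a\<in>B. of_int (c a) *\<^sub>R a) ` (\<Pi>\<^sub>E b\<in>B. {- C b..C b})"
  proof
    fix x assume x: "x \<in> int_span B \<inter> S"
    then obtain c :: "'a \<Rightarrow> int" where c: "x = (\<Sum>a\<in>B. of_int (c a) *\<^sub>R a)"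
      unfolding int_span_def by blast
    \<comment> \<open>Values of \<open>c\<close> outside \<open>B\<close> do not affect the sum;
      fixing them by \<open>restrict\<close> leaves only finitely many coefficient
      functions.\<close>
    have "x = (\<Sum>a\<in>B. of_int (restrict c B a) *\<^sub>R a)" unfolding c by (intro sum.cong) auto
    moreover have "restrict c B \<in> (\<Pi>\<^sub>E b\<in>B. {- C b..C b})"
      using C[of _ c] x c by (force simp: abs_le_iff)
    ultimately show "x \<in> (\<lambda>c. \<Sum>a\<in>B. of_int (c a) *\<^sub>R a) ` (\<Pi>\<^sub>E b\<in>B. {- C b..C b})"
      by blast
  qed
  moreover have "finite (\<Pi>\<^sub>E b\<in>B. {- C b..C b})" using fin by (intro finite_PiE) auto
  ultimately show ?thesis by (meson finite_imageI finite_subset)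
qed

section \<open>Fundamental cells and Blichfeldt's principle\<close>

lemma convex_fundamental_cell: "convex (fundamental_cell B)"
proof (rule convexI)
  fix x y :: 'a and s t :: real
  assume "x \<in> fundamental_cell B" "y \<in> fundamental_cell B" and st: "0 \<le> s" "0 \<le> t" "s + t = 1"
  then obtain u v where x: "x = (\<Sum>b\<in>B. u b *\<^sub>R b)" "\<forall>b\<in>B. 0 \<le> u b \<and> u b < 1"
    and y: "y = (\<Sum>b\<in>B. v b *\<^sub>R b)" "\<forall>b\<in>B. 0 \<le> v b \<and> v b < 1"
    unfolding fundamental_cell_def by blast
  have "s *\<^sub>R x + t *\<^sub>R y = (\<Sum>b\<in>B. (s * u b + t * v b) *\<^sub>R b)"
    using x y by (simp add: scaleR_sum_right scaleR_add_left sum.distrib)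
  moreover have "0 \<le> s * u b + t * v b \<and> s * u b + t * v b < 1" if "b \<in> B" for b
    using x(2) y(2) that st convex_bound_lt[of "u b" 1 "v b" s t] by auto
  ultimately show "s *\<^sub>R x + t *\<^sub>R y \<in> fundamental_cell B"
    unfolding fundamental_cell_def by (auto intro!: exI[of _ "\<lambda>b. s * u b + t * v b"])
qed

lemma bounded_fundamental_cell: "bounded (fundamental_cell B)"
  unfolding bounded_iff
proof (intro exI ballI)
  fix x assume "x \<in> fundamental_cell B"
  then obtain u where x: "x = (\<Sum>b\<in>B. u b *\<^sub>R b)" "\<forall>b\<in>B. 0 \<le> u b \<and> u b < 1"
    unfolding fundamental_cell_def by blast
  show "norm x \<le> (\<Sum>b\<in>B. norm b)"
    unfolding x(1) using x(2) by (intro sum_norm_le) (auto simp: mult_left_le_one_le)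
qed

text \<open>Rounding the coordinates down leaves their fractional parts, which are the coordinates
  of a point of the cell.\<close>

lemma fundamental_cell_cover:
  fixes B :: "'a::euclidean_space set"
  assumes "finite B" "span B = UNIV"
  obtains g where "g \<in> int_span B" "x - g \<in> fundamental_cell B"
proof -
  have "x \<in> range (\<lambda>u. \<Sum>b\<in>B. u b *\<^sub>R b)"
    unfolding span_finite[OF assms(1), symmetric] assms(2) by simp
  then obtain u where u: "x = (\<Sum>b\<in>B. u b *\<^sub>R b)" by blast
  have "(\<Sum>b\<in>B. of_int \<lfloor>u b\<rfloor> *\<^sub>R b) \<in> int_span B"
    by (rule int_span_memI)
  moreover have "x - (\<Sum>b\<in>B. of_int \<lfloor>u b\<rfloor> *\<^sub>R b) = (\<Sum>b\<in>B. frac (u b) *\<^sub>R b)"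
    by (simp add: u frac_def sum_subtractf scaleR_diff_left)
  then have "x - (\<Sum>b\<in>B. of_int \<lfloor>u b\<rfloor> *\<^sub>R b) \<in> fundamental_cell B"
    unfolding fundamental_cell_def by (auto intro!: exI[of _ "\<lambda>b. frac (u b)"] simp: frac_lt_1)
  ultimately show thesis using that by blast
qed

text \<open>Blichfeldt's principle for a finite family of sets, overlaps being counted with multiplicity.\<close>

lemma blichfeldt_family:
  fixes B :: "'a::euclidean_space set" and S :: "'i \<Rightarrow> 'a set"
  assumes B: "finite B" "independent B" "span B = UNIV" and I: "finite I"
    and S: "\<And>k. k \<in> I \<Longrightarrow> S k \<in> lmeasurable" "\<And>k. k \<in> I \<Longrightarrow> bounded (S k)"
    and less: "measure lebesgue (fundamental_cell B) < (\<Sum>k\<in>I. measure lebesgue (S k))"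
  shows "\<exists>k\<in>I. \<exists>l\<in>I. \<exists>x\<in>S k. \<exists>y\<in>S l. (k, x) \<noteq> (l, y) \<and> x - y \<in> int_span B"
proof (rule ccontr)
  assume none: "\<not> ?thesis"
  then have inj: "(k, x) = (l, y)"
    if "k \<in> I" "l \<in> I" "x \<in> S k" "y \<in> S l" "x - y \<in> int_span B" for k l x y
    using that none by blast
  let ?F = "fundamental_cell B"
  have F: "?F \<in> lmeasurable"
    by (simp add: measurable_convex convex_fundamental_cell bounded_fundamental_cell)
  \<comment> \<open>A lattice vector \<open>g\<close> can carry a point of some \<open>S k\<close>
    into the cell by subtraction only if it lies in the bounded set \<open>D\<close>, so finitely
    many \<open>g\<close> matter.\<close>
  define D where "D = (\<lambda>(x, y). x - y) ` ((\<Union>k\<in>I. S k) \<times> ?F)"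
  define G where "G = int_span B \<inter> D"
  have "bounded D" unfolding D_def
    using S(2) I bounded_fundamental_cell[of B]
    by (auto simp: case_prod_unfold intro!: bounded_minus_comp bounded_fst bounded_snd bounded_Times)
  then have G: "finite G" unfolding G_def by (rule finite_int_span_Int_bounded[OF B(2)])
  \<comment> \<open>The part of \<open>S k\<close> in the cell translated by \<open>g\<close>, moved
    back into the cell.\<close>
  define T where "T = (\<lambda>(k, g). ((\<lambda>x. x - g) ` S k) \<inter> ?F)"
  have T: "T p \<in> lmeasurable" if "p \<in> I \<times> G" for p
    using that S(1) F by (auto simp: T_def intro!: fmeasurable.Int measurable_translation_subtract)
  have TD: "z + g \<in> S k" if "z \<in> T (k, g)" for z k g
    using that by (auto simp only: T_def case_prod_conv Int_iff image_iff diff_add_cancel)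
  have disj: "disjoint_family_on T (I \<times> G)"
  proof (clarsimp simp: disjoint_family_on_def)
    fix k g l h
    assume *: "k \<in> I" "g \<in> G" "l \<in> I" "h \<in> G" "k = l \<longrightarrow> g \<noteq> h"
    \<comment> \<open>A common point \<open>z\<close> would give points \<open>z + g\<close> and
      \<open>z + h\<close> of the family that are congruent modulo the lattice; \<open>inj\<close>
      then forces equal indices and \<open>g = h\<close>.\<close>
    have False if "z \<in> T (k, g)" "z \<in> T (l, h)" for z
    proof -
      have "z + g \<in> S k" "z + h \<in> S l" using that TD by auto
      moreover have "(z + g) - (z + h) \<in> int_span B"
        using * by (auto simp: G_def intro: int_span_diff)
      ultimately show False using inj[of k l "z + g" "z + h"] * by auto
    qed
    then show "T (k, g) \<inter> T (l, h) = {}" by blast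
  qed
  \<comment> \<open>The pieces, moved back to their places, cover \<open>S k\<close>, and
    translation preserves volume.\<close>
  have "measure lebesgue (S k) \<le> (\<Sum>g\<in>G. measure lebesgue (T (k, g)))" if k: "k \<in> I" for k
  proof -
    have "S k \<subseteq> (\<Union>g\<in>G. (+) g ` T (k, g))"
    proof
      fix x assume x: "x \<in> S k"
      obtain g where g: "g \<in> int_span B" "x - g \<in> ?F" using fundamental_cell_cover[OF B(1,3)] .
      have "(x, x - g) \<in> (\<Union>k\<in>I. S k) \<times> ?F" using x k g by auto
      then have "g \<in> D" unfolding D_def by (force intro!: image_eqI)
      moreover have "x \<in> (+) g ` T (k, g)"
        using x g by (intro image_eqI[of _ _ "x - g"]) (auto simp: T_def)
      ultimately show "x \<in> (\<Union>g\<in>G. (+) g ` T (k, g))" using g by (auto simp: G_def)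
    qed
    moreover have M: "(+) g ` T (k, g) \<in> lmeasurable" if "g \<in> G" for g
      using T[of "(k, g)"] that k by (intro measurable_translation) auto
    ultimately have "measure lebesgue (S k) \<le> measure lebesgue (\<Union>g\<in>G. (+) g ` T (k, g))"
      using S(1)[OF k] G by (intro measure_mono_fmeasurable) (auto intro!: fmeasurable.finite_UN)
    also have "\<dots> \<le> (\<Sum>g\<in>G. measure lebesgue ((+) g ` T (k, g)))"
      using G M by (intro measure_UNION_le) auto
    finally show ?thesis by (simp add: measure_translation)
  qed
  then have "(\<Sum>k\<in>I. measure lebesgue (S k)) \<le> (\<Sum>k\<in>I. \<Sum>g\<in>G. measure lebesgue (T (k, g)))"
    by (rule sum_mono)
  also have "\<dots> = (\<Sum>p\<in>I \<times> G. measure lebesgue (T p))"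
    by (simp add: sum.cartesian_product)
  \<comment> \<open>The pieces are disjoint and all lie in one cell, so their total volume is at
    most that of the cell.\<close>
  also have "\<dots> = measure lebesgue (\<Union>p\<in>I \<times> G. T p)"
    using T I G disj fmeasurableD2[OF T]
    by (intro measure_finite_Union[symmetric]) (auto simp only: infinity_ennreal_def intro: fmeasurableD)
  also have "\<dots> \<le> measure lebesgue ?F"
    using T I G F by (intro measure_mono_fmeasurable) (auto simp: T_def)
  finally show False using less by simp
qed

section \<open>The norm with unit ball \<open>K\<close>\<close>

definition minkowski_functional :: "'a::euclidean_space set \<Rightarrow> 'a \<Rightarrow> real" where
  "minkowski_functional K x = Inf {t. 0 \<le> t \<and> x \<in> (\<lambda>y. t *\<^sub>R y) ` K}"

locale symmetric_body =
  fixes K :: "'a::euclidean_space set"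
  assumes body: "o_symmetric_convex_body K" and interior_nonempty: "interior K \<noteq> {}"
begin

abbreviation N :: "'a \<Rightarrow> real" where "N \<equiv> minkowski_functional K"

lemma compact_K: "compact K" and convex_K: "convex K"
  using body by (auto simp: o_symmetric_convex_body_def)

lemma uminus_K: "x \<in> K \<Longrightarrow> - x \<in> K"
  using body by (auto simp: o_symmetric_convex_body_def)

text \<open>If a ball around \<open>x\<close> lies in \<open>K\<close>, then a small
  \<open>y\<close> is the midpoint of \<open>x + y\<close> and of the reflection of
  \<open>x - y\<close>.\<close>

lemma zero_interior: "0 \<in> interior K"
proof -
  obtain x e where e: "e > 0" "ball x e \<subseteq> K"
    using interior_nonempty by (auto simp: mem_interior)
  have "ball 0 e \<subseteq> K"
  proof
    fix y :: 'a assume "y \<in> ball 0 e"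
    then have "x + y \<in> K" "x - y \<in> K" using e by (auto simp: subset_iff dist_norm)
    from convexD[OF convex_K this(1) uminus_K[OF this(2)], of "1/2" "1/2"]
    show "y \<in> K" by (simp add: algebra_simps flip: scaleR_add_left)
  qed
  then show ?thesis using e mem_interior by blast
qed

lemma zero_K: "0 \<in> K"
  using zero_interior interior_subset by blast

lemma scaled_mono:
  assumes "0 \<le> s" "s \<le> t" "x \<in> (\<lambda>y. s *\<^sub>R y) ` K"
  shows "x \<in> (\<lambda>y. t *\<^sub>R y) ` K"
proof (cases "t = 0")
  case True
  then show ?thesis using assms by auto
next
  case False
  obtain y where y: "y \<in> K" "x = s *\<^sub>R y" using assms by auto
  have "(s / t) *\<^sub>R y \<in> K"
    using convexD[OF convex_K y(1) zero_K, of "s / t" "1 - s / t"] assms False by auto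
  moreover have "x = t *\<^sub>R ((s / t) *\<^sub>R y)" using y False by simp
  ultimately show ?thesis by blast
qed

lemma scaled_exists: "\<exists>t\<ge>0. x \<in> (\<lambda>y. t *\<^sub>R y) ` K"
proof (cases "x = 0")
  case True
  then show ?thesis using zero_K by force
next
  case False
  obtain e where e: "e > 0" "ball 0 e \<subseteq> K" using zero_interior by (auto simp: mem_interior)
  have "(e / (2 * norm x)) *\<^sub>R x \<in> K" using e False by (auto simp: subset_iff)
  moreover have "x = (2 * norm x / e) *\<^sub>R ((e / (2 * norm x)) *\<^sub>R x)" using e False by simp
  ultimately have "x \<in> (\<lambda>y. (2 * norm x / e) *\<^sub>R y) ` K" by (rule rev_image_eqI)
  then show ?thesis using e by (intro exI[of _ "2 * norm x / e"]) auto
qed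

text \<open>Compactness of \<open>K\<close> makes the points \<open>y n\<close> with
  \<open>x = s n *\<^sub>R y n\<close> converge along a subsequence. Closedness turns the infimum
  defining \<open>N\<close> into a minimum.\<close>

lemma closed_scaling_factors: "closed {t. 0 \<le> t \<and> x \<in> (\<lambda>y. t *\<^sub>R y) ` K}"
  unfolding closed_sequential_limits
proof (intro allI impI, elim conjE)
  fix s l assume s: "\<forall>n. s n \<in> {t. 0 \<le> t \<and> x \<in> (\<lambda>y. t *\<^sub>R y) ` K}" and l: "s \<longlonglongrightarrow> l"
  then have "\<forall>n. \<exists>y. y \<in> K \<and> x = s n *\<^sub>R y" by auto
  then obtain y where y: "\<And>n. y n \<in> K" "\<And>n. x = s n *\<^sub>R y n" by metis
  obtain z r where z: "z \<in> K" "strict_mono r" "(y \<circ> r) \<longlonglongrightarrow> z"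
    using compact_K y(1) unfolding compact_def by metis
  have "(\<lambda>n. (s \<circ> r) n *\<^sub>R (y \<circ> r) n) \<longlonglongrightarrow> l *\<^sub>R z"
    by (rule tendsto_scaleR[OF LIMSEQ_subseq_LIMSEQ[OF l z(2)] z(3)])
  moreover have "(\<lambda>n. (s \<circ> r) n *\<^sub>R (y \<circ> r) n) = (\<lambda>_. x)" using y(2) by auto
  ultimately have "x = l *\<^sub>R z" by (simp add: LIMSEQ_const_iff)
  moreover have "0 \<le> l" using l s by (intro LIMSEQ_le_const) auto
  ultimately show "l \<in> {t. 0 \<le> t \<and> x \<in> (\<lambda>y. t *\<^sub>R y) ` K}" using z by auto
qed

lemma N_attained: "N x \<in> {t. 0 \<le> t \<and> x \<in> (\<lambda>y. t *\<^sub>R y) ` K}"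
  unfolding minkowski_functional_def
  using scaled_exists[of x] closed_scaling_factors[of x]
  by (intro closed_contains_Inf) (auto intro!: bdd_belowI[of _ 0])

lemma N_nonneg: "0 \<le> N x"
  using N_attained by blast

lemma N_le_iff:
  assumes "0 \<le> t"
  shows "N x \<le> t \<longleftrightarrow> x \<in> (\<lambda>y. t *\<^sub>R y) ` K"
proof
  assume "N x \<le> t"
  then show "x \<in> (\<lambda>y. t *\<^sub>R y) ` K" using scaled_mono[of "N x" t x] N_attained by blast
next
  assume "x \<in> (\<lambda>y. t *\<^sub>R y) ` K"
  then show "N x \<le> t" unfolding minkowski_functional_def
    using assms by (intro cInf_lower) (auto intro!: bdd_belowI[of _ 0])
qed

lemma N_leI: "0 \<le> t \<Longrightarrow> k \<in> K \<Longrightarrow> x = t *\<^sub>R k \<Longrightarrow> N x \<le> t"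
  using N_le_iff by blast

lemma N_unit: obtains k where "k \<in> K" "x = N x *\<^sub>R k"
  using N_attained[of x] that by auto

lemma N_pos: "x \<noteq> 0 \<Longrightarrow> 0 < N x"
  using N_attained[of x] by (cases "N x = 0") auto

lemma N_triangle: "N (x + y) \<le> N x + N y"
proof (cases "N x + N y = 0")
  case True
  then have "x = 0" "y = 0"
    using N_pos[of x] N_pos[of y] N_nonneg[of x] N_nonneg[of y] by linarith+
  then show ?thesis using N_nonneg[of "0::'a"] by simp
next
  case False
  then have pos: "N x + N y > 0" using N_nonneg[of x] N_nonneg[of y] by linarith
  obtain k where k: "k \<in> K" "x = N x *\<^sub>R k" by (rule N_unit)
  obtain l where l: "l \<in> K" "y = N y *\<^sub>R l" by (rule N_unit)
  let ?s = "N x + N y"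
  have "(N x / ?s) *\<^sub>R k + (N y / ?s) *\<^sub>R l \<in> K"
    using pos N_nonneg
    by (intro convexD[OF convex_K k(1) l(1)]) (auto simp flip: add_divide_distrib)
  moreover have "x + y = ?s *\<^sub>R ((N x / ?s) *\<^sub>R k + (N y / ?s) *\<^sub>R l)"
    using pos k(2) l(2) by (simp add: scaleR_add_right)
  ultimately show ?thesis using pos by (intro N_leI) auto
qed

text \<open>A negative sign of \<open>c\<close> is absorbed by the symmetry of
  \<open>K\<close>.\<close>

lemma N_scale_le: "N (c *\<^sub>R x) \<le> \<bar>c\<bar> * N x"
proof -
  obtain k where k: "k \<in> K" "x = N x *\<^sub>R k" by (rule N_unit)
  have "c *\<^sub>R x = (c * N x) *\<^sub>R k" using arg_cong[OF k(2), of "\<lambda>y. c *\<^sub>R y"] by simp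
  also have "\<dots> = (\<bar>c\<bar> * N x) *\<^sub>R (if c < 0 then - k else k)" by simp
  finally have "c *\<^sub>R x = (\<bar>c\<bar> * N x) *\<^sub>R (if c < 0 then - k else k)" .
  moreover have "(if c < 0 then - k else k) \<in> K" using k(1) uminus_K by simp
  ultimately show ?thesis using N_nonneg by (intro N_leI[OF mult_nonneg_nonneg]) auto
qed

lemma N_minus: "N (- x) = N x"
  using N_scale_le[of "-1" x] N_scale_le[of "-1" "- x"] by simp

lemma N_diff: "N (x - y) \<le> N x + N y"
  using N_triangle[of x "- y"] by (simp add: N_minus)

text \<open>An interior point can be stretched by a factor \<open>1 + d\<close> without leaving
  \<open>K\<close>. The strictness makes differences of points of one open ball of radius
  \<open>lam / 2\<close> shorter than \<open>lam\<close>.\<close>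

lemma N_interior:
  assumes "x \<in> interior K" shows "N x < 1"
proof -
  obtain e where e: "e > 0" "ball x e \<subseteq> K" using assms by (auto simp: mem_interior)
  \<comment> \<open>The \<open>+ 1\<close> covers \<open>x = 0\<close> and keeps
    \<open>norm (d *\<^sub>R x)\<close> strictly below \<open>e\<close>.\<close>
  define d where "d = e / (norm x + 1)"
  have d: "d > 0" using e by (simp add: d_def add_nonneg_pos)
  have "norm (d *\<^sub>R x) < e"
  proof -
    have "norm (d *\<^sub>R x) = e * (norm x / (norm x + 1))" using e by (simp add: d_def)
    also have "norm x / (norm x + 1) < 1"
      by (subst divide_less_eq_1_pos) (auto intro: add_nonneg_pos)
    then have "e * (norm x / (norm x + 1)) < e * 1" using e by (intro mult_strict_left_mono)
    finally show ?thesis by simp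
  qed
  then have "x + d *\<^sub>R x \<in> K" using e by (auto simp: subset_iff dist_norm)
  moreover have "x = (1 / (1 + d)) *\<^sub>R (x + d *\<^sub>R x)"
    using d by (simp flip: scaleR_add_left[of 1, simplified])
  ultimately have "N x \<le> 1 / (1 + d)" using d by (intro N_leI) auto
  also have "\<dots> < 1" using d by simp
  finally show ?thesis .
qed

lemma measure_K_pos: "0 < measure lebesgue K"
proof -
  have "K \<in> lmeasurable" using compact_K by (rule lmeasurable_compact)
  moreover have "\<not> negligible K"
    using open_not_negligible[OF open_interior interior_nonempty] negligible_subset interior_subset
    by blast
  ultimately show ?thesis using negligible_iff_measure[of K] measure_nonneg[of lebesgue K]
    by linarith
qed

section \<open>Sublevel sets and successive minima\<close>

lemma bounded_sublevel: "bounded {x. N x \<le> t}"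
proof (cases "0 \<le> t")
  case True
  then have "{x. N x \<le> t} = (\<lambda>y. t *\<^sub>R y) ` K" using N_le_iff by blast
  then show ?thesis using compact_K by (simp add: bounded_scaling compact_imp_bounded)
next
  case False
  then have "{x. N x \<le> t} = {}" using N_nonneg by (smt (verit, best) empty_Collect_eq)
  then show ?thesis by simp
qed

lemma finite_sublevel:
  assumes "independent B" "X \<subseteq> int_span B"
  shows "finite {x \<in> X. N x \<le> t}"
  by (rule finite_subset[OF _ finite_int_span_Int_bounded[OF assms(1) bounded_sublevel[of t]]])
    (use assms(2) in auto)

lemma scaled_Int: "0 \<le> t \<Longrightarrow> (\<lambda>x. t *\<^sub>R x) ` K \<inter> X = {x \<in> X. N x \<le> t}"
  using N_le_iff by blast

text \<open>\<open>LEAST\<close> on the reals guarantees no existence. Finite sublevel sets reduce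
  the search to 0 and finitely many values of \<open>N\<close>, among which a least admissible one
  exists.\<close>

lemma successive_minimum_attained:
  assumes fin: "\<And>t. finite {x \<in> X. N x \<le> t}"
    and t0: "0 \<le> t0" "i \<le> dim {x \<in> X. N x \<le> t0}"
  shows successive_minimum_nonneg: "0 \<le> successive_minimum K X i"
    and dim_successive_minimum: "i \<le> dim {x \<in> X. N x \<le> successive_minimum K X i}"
    and successive_minimum_le:
      "\<And>t. 0 \<le> t \<Longrightarrow> i \<le> dim {x \<in> X. N x \<le> t} \<Longrightarrow> successive_minimum K X i \<le> t"
proof -
  define P where "P t \<longleftrightarrow> 0 \<le> t \<and> i \<le> dim {x \<in> X. N x \<le> t}" for t
  define V where "V = insert 0 (N ` {x \<in> X. N x \<le> t0})"
  have V: "finite V" using fin by (simp add: V_def)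
  \<comment> \<open>The sublevel set changes only at values of \<open>N\<close> on \<open>X\<close>:
    lowering \<open>t\<close> to the largest element of \<open>V\<close> not above it loses no
    vector. The inserted 0 keeps that maximum defined.\<close>
  have down: "\<exists>v\<in>V. P v \<and> v \<le> t" if "P t" "t \<le> t0" for t
  proof -
    let ?W = "{v \<in> V. v \<le> t}"
    have W: "finite ?W" "0 \<in> ?W" using V that by (auto simp: V_def P_def)
    then have m: "Max ?W \<in> ?W" using Max_in by blast
    have "{x \<in> X. N x \<le> t} \<subseteq> {x \<in> X. N x \<le> Max ?W}"
      using W that by (auto simp: V_def intro!: Max_ge)
    from dim_subset[OF this] have "P (Max ?W)" using that W by (auto simp: P_def)
    then show ?thesis using m by blast
  qed
  have Pt0: "P t0" using t0 by (simp add: P_def)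
  let ?m = "Min {v \<in> V. P v}"
  have ne: "{v \<in> V. P v} \<noteq> {}" using down[OF Pt0] by blast
  then have Pm: "P ?m" using Min_in[of "{v \<in> V. P v}"] V by auto
  have le: "?m \<le> t" if "P t" for t
  proof -
    \<comment> \<open>\<open>V\<close> records values only up to \<open>t0\<close>, so a larger
      \<open>t\<close> is first cut down to \<open>t0\<close>.\<close>
    have "P (min t t0)" using that Pt0 by (simp add: min_def)
    from down[OF this] obtain v where "v \<in> V" "P v" "v \<le> min t t0" by auto
    moreover have "?m \<le> v" using V calculation by (intro Min_le) auto
    ultimately show ?thesis by linarith
  qed
  have "successive_minimum K X i = (LEAST t. P t)"
    unfolding successive_minimum_def P_def by (metis scaled_Int)
  also have "\<dots> = ?m" using Pm le by (rule Least_equality)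
  finally have eq: "successive_minimum K X i = ?m" .
  show "0 \<le> successive_minimum K X i" "i \<le> dim {x \<in> X. N x \<le> successive_minimum K X i}"
    using Pm unfolding eq P_def by auto
  show "successive_minimum K X i \<le> t" if "0 \<le> t" "i \<le> dim {x \<in> X. N x \<le> t}" for t
    using le that unfolding eq P_def by blast
qed

text \<open>The sum of the norms of the basis vectors is a radius that catches all of
  \<open>B\<close>. It supplies the \<open>t0\<close> of
  \<open>successive_minimum_attained\<close>.\<close>

lemma full_rank_sublevel:
  assumes "independent B" "span B = UNIV" "i \<le> DIM('a)"
  shows "\<exists>t\<ge>0. i \<le> dim {x \<in> int_span B. N x \<le> t}"
proof -
  have fin: "finite B" using assms(1) by (rule finiteI_independent)
  let ?t = "\<Sum>b\<in>B. N b"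
  have "N b \<le> ?t" if "b \<in> B" for b using fin that N_nonneg by (intro member_le_sum) auto
  then have "B \<subseteq> {x \<in> int_span B. N x \<le> ?t}" using int_span_superset[OF fin] by blast
  from dim_subset[OF this] have "DIM('a) \<le> dim {x \<in> int_span B. N x \<le> ?t}"
    using assms(2) by (metis dim_UNIV dim_span)
  then show ?thesis using assms(3) N_nonneg by (intro exI[of _ ?t]) (auto intro: sum_nonneg)
qed

section \<open>Packing balls along a segment modulo the sublattice\<close>

text \<open>The exponent \<open>DIM('a) - 1\<close> leaves one factor \<open>lam\<close> to be
  supplied by the number of balls: \<open>m + 1\<close> of them put \<open>(m + 1) * lam\<close> in
  the place of \<open>t\<close>.\<close>

lemma short_vector_outside_sublattice:
  assumes B: "independent B" "span B = UNIV"
    and L1: "int_span B1 \<subset> int_span B"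
    and lam: "0 < lam" "\<And>g. g \<in> int_span B1 \<Longrightarrow> g \<noteq> 0 \<Longrightarrow> lam \<le> N g"
    and t: "0 \<le> t"
    and vol: "2 ^ DIM('a) * measure lebesgue (fundamental_cell B)
                \<le> t * lam ^ (DIM('a) - 1) * measure lebesgue K"
  shows "\<exists>a\<in>int_span B - int_span B1. N a \<le> t + lam"
proof -
  have finB: "finite B" using B(1) by (rule finiteI_independent)
  obtain a0 where a0: "a0 \<in> int_span B - int_span B1" using L1 by blast
  \<comment> \<open>Only finitely many candidates are no longer than \<open>a0\<close>, so a
    shortest one exists.\<close>
  let ?A = "{x \<in> int_span B - int_span B1. N x \<le> N a0}"
  have finA: "finite ?A" by (rule finite_sublevel[OF B(1)]) auto
  define a where "a = arg_min_on N ?A"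
  have aA: "a \<in> ?A" unfolding a_def using finA a0 by (intro arg_min_if_finite) auto
  have amin: "N a \<le> N x" if "x \<in> int_span B" "x \<notin> int_span B1" for x
  proof (cases "N x \<le> N a0")
    case True
    then show ?thesis unfolding a_def using that finA a0 by (intro arg_min_least) auto
  qed (use aA in auto)
  define tau where "tau = N a"
  have "tau \<le> t + lam"
  proof (rule ccontr)
    assume "\<not> tau \<le> t + lam"
    then have tau: "t + lam < tau" by simp
    have tau0: "0 < tau" using tau t lam by linarith
    \<comment> \<open>As \<open>a\<close> is a shortest vector of its coset of \<open>L1\<close>, so are the points of the segment up to \<open>a\<close>.\<close>
    have far: "s * tau \<le> N (s *\<^sub>R a - g)" if "0 \<le> s" "s \<le> 1" "g \<in> int_span B1" for s g
    proof -
      have "a - g \<notin> int_span B1" using int_span_add[of "a - g" B1 g] that aA by auto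
      moreover have "a - g \<in> int_span B" using aA that L1 by (intro int_span_diff) auto
      ultimately have "tau \<le> N (a - g)" unfolding tau_def using amin by blast
      also have "a - g = (s *\<^sub>R a - g) + (1 - s) *\<^sub>R a" by (simp add: algebra_simps)
      also have "N \<dots> \<le> N (s *\<^sub>R a - g) + (1 - s) * tau"
        using N_triangle[of "s *\<^sub>R a - g" "(1 - s) *\<^sub>R a"] N_scale_le[of "1 - s" a] that
        by (simp add: tau_def)
      finally show ?thesis by (simp add: algebra_simps)
    qed
    \<comment> \<open>For negative \<open>s\<close>, the symmetry of \<open>N\<close> allows passing
      to \<open>- s\<close> and \<open>- g\<close>.\<close>
    have far_abs: "\<bar>s\<bar> * tau \<le> N (s *\<^sub>R a - g)" if "\<bar>s\<bar> \<le> 1" "g \<in> int_span B1" for s g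
    proof (cases "0 \<le> s")
      case False
      have "- g \<in> int_span B1" using int_span_diff[OF zero_in_int_span that(2)] by simp
      then show ?thesis using far[of "- s" "- g"] N_minus[of "s *\<^sub>R a - g"] that False by simp
    qed (use far that in auto)
    \<comment> \<open>The last centre is still within distance \<open>t\<close> of 0, while
      \<open>(m + 1) * lam\<close> exceeds \<open>t\<close> strictly; the indices run from 0 to
      \<open>m\<close>.\<close>
    define m where "m = nat \<lfloor>t / lam\<rfloor>"
    \<comment> \<open>Since \<open>N a\<close> is \<open>tau\<close>, the point
      \<open>c k *\<^sub>R a\<close> has norm \<open>k * lam\<close>; \<open>S k\<close> is the open
      ball of radius \<open>lam / 2\<close> around it.\<close>
    define c where "c k = real k * lam / tau" for k
    define S where "S k = (\<lambda>x. (lam / 2) *\<^sub>R x + c k *\<^sub>R a) ` interior K" for k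
    have m: "real m * lam \<le> t" "t < (real m + 1) * lam"
    proof -
      have "real m \<le> t / lam" "t / lam < real m + 1" using t lam by (auto simp: m_def)
      then show "real m * lam \<le> t" "t < (real m + 1) * lam" using lam by (auto simp: field_simps)
    qed
    have S_alt: "S k = (\<lambda>x. c k *\<^sub>R a + (lam / 2) *\<^sub>R x) ` interior K" for k
      by (simp add: S_def add.commute)
    have bS: "bounded (S k)" for k
      unfolding S_alt using bounded_translation[OF bounded_scaling[OF bounded_interior[OF compact_imp_bounded[OF compact_K]]]]
      by (simp add: image_image)
    have "convex (S k)" for k
      unfolding S_alt by (intro convex_affinity convex_interior convex_K)
    with bS have mS: "S k \<in> lmeasurable" for k by (simp add: measurable_convex)
    have "measure lebesgue (interior K) = measure lebesgue K"
      using convex_K compact_K by (intro measure_interior negligible_convex_frontier compact_imp_bounded)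
    then have volS: "measure lebesgue (S k) = (lam / 2) ^ DIM('a) * measure lebesgue K" for k
      using measure_lebesgue_affine[of "lam / 2" "c k *\<^sub>R a" "interior K"] lam
      by (simp add: S_def)
    have "measure lebesgue (fundamental_cell B) < (\<Sum>k\<in>{..m}. measure lebesgue (S k))"
    proof -
      have pow: "lam ^ DIM('a) = lam * lam ^ (DIM('a) - 1)"
        by (metis DIM_positive power_eq_if less_numeral_extra(3))
      have "2 ^ DIM('a) * measure lebesgue (fundamental_cell B)
          \<le> t * (lam ^ (DIM('a) - 1) * measure lebesgue K)" using vol by (simp add: mult.assoc)
      also have "\<dots> < ((real m + 1) * lam) * (lam ^ (DIM('a) - 1) * measure lebesgue K)"
        using m(2) lam measure_K_pos by (intro mult_strict_right_mono) auto
      also have "\<dots> = 2 ^ DIM('a) * (\<Sum>k\<in>{..m}. measure lebesgue (S k))"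
        by (simp add: volS pow power_divide)
      finally show ?thesis by simp
    qed
    from blichfeldt_family[OF finB B finite_atMost mS bS this]
    obtain k l x y where kl: "k \<le> m" "l \<le> m" "x \<in> S k" "y \<in> S l" "(k, x) \<noteq> (l, y)"
      and g: "x - y \<in> int_span B" by blast
    obtain u where u: "u \<in> interior K" "x = (lam / 2) *\<^sub>R u + c k *\<^sub>R a"
      using kl(3) by (auto simp: S_def)
    obtain v where v: "v \<in> interior K" "y = (lam / 2) *\<^sub>R v + c l *\<^sub>R a"
      using kl(4) by (auto simp: S_def)
    define w where "w = (lam / 2) *\<^sub>R (u - v)"
    define s where "s = c k - c l"
    have xy: "x - y = s *\<^sub>R a + w"
      by (simp add: u v w_def s_def algebra_simps)
    have Nw: "N w < lam"
    proof -
      have "N (u - v) < 2" using N_diff[of u v] N_interior[OF u(1)] N_interior[OF v(1)] by linarith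
      then have "lam / 2 * N (u - v) < lam" using lam by simp
      moreover have "N w \<le> lam / 2 * N (u - v)"
        using N_scale_le[of "lam / 2" "u - v"] lam(1) by (simp add: w_def)
      ultimately show ?thesis by linarith
    qed
    have s_tau: "\<bar>s\<bar> * tau = \<bar>real k - real l\<bar> * lam"
    proof -
      have "s = (real k - real l) * lam / tau" by (simp add: s_def c_def diff_divide_distrib left_diff_distrib)
      then show ?thesis using tau0 lam by (simp add: abs_mult)
    qed
    have "\<bar>real k - real l\<bar> \<le> real m" using kl by linarith
    then have s_le: "\<bar>s\<bar> * tau \<le> t"
      unfolding s_tau using m(1) lam by (meson mult_right_mono less_imp_le order_trans)
    \<comment> \<open>The centres are at most \<open>t\<close> apart and \<open>w\<close> is shorter
      than \<open>lam\<close>, so \<open>x - y\<close> is shorter than the minimiser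
      \<open>a\<close> and must lie in the sublattice.\<close>
    have "N (x - y) < tau"
      using N_triangle[of "s *\<^sub>R a" w] N_scale_le[of s a] Nw s_le tau by (simp add: xy tau_def)
    then have g1: "x - y \<in> int_span B1" using amin[OF g] by (force simp: tau_def)
    have "\<bar>s\<bar> * tau \<le> 1 * tau" using s_le tau lam by linarith
    then have "\<bar>s\<bar> \<le> 1" using tau0 mult_le_cancel_right_pos by blast
    \<comment> \<open>With \<open>g = x - y\<close>, the vector \<open>s *\<^sub>R a - g\<close> is
      \<open>- w\<close>. Hence the centres are less than \<open>lam\<close> apart and the indices
      coincide.\<close>
    from far_abs[OF this g1] have "\<bar>s\<bar> * tau \<le> N w" by (simp add: xy N_minus)
    then have "\<bar>real k - real l\<bar> * lam < 1 * lam" using Nw s_tau by linarith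
    then have "\<bar>real k - real l\<bar> < 1" using lam(1) by (simp only: mult_less_cancel_right_pos)
    then have "k = l" by linarith
    \<comment> \<open>With equal indices the points differ, and \<open>w\<close> is a nonzero
      sublattice vector shorter than \<open>lam\<close>.\<close>
    then have "x - y \<noteq> 0" "x - y = w" using kl(5) xy by (auto simp: s_def)
    then show False using lam(2)[OF g1] Nw by simp
  qed
  then show ?thesis using aA by (auto simp: tau_def)
qed

end

section \<open>Full-rank lattices and the bound for the restricted minima\<close>

text \<open>The basis picked by \<open>SOME\<close> in \<open>lattice_det\<close> need not be the
  one witnessing the rank; but the latter lies in the integer span of the former and spans the
  space.\<close>

lemma lattice_basis_full_rank:
  fixes L B :: "'a::euclidean_space set"
  assumes "lattice_of_rank DIM('a) L" "lattice_basis L B"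
  shows "span B = UNIV"
proof -
  obtain C where C: "independent C" "L = int_span C" "card C = DIM('a)"
    using assms(1) by (auto simp: lattice_of_rank_def lattice_basis_def)
  have "C \<subseteq> int_span B"
    using int_span_superset[OF finiteI_independent[OF C(1)]] C(2) assms(2)
    by (simp add: lattice_basis_def)
  also have "\<dots> \<subseteq> span B"
    by (auto simp: int_span_def intro: span_sum span_scale span_base)
  finally have "span C \<subseteq> span B" by (simp add: span_minimal)
  moreover have "span C = UNIV"
    using C by (metis card_eq_dim dim_eq_full dim_eq_card_independent)
  ultimately show ?thesis by blast
qed

theorem corollary3p6:
  fixes K L L1 :: "(real ^ 'n) set" and i :: nat
  assumes "CARD('n) \<ge> 2"
    and "o_symmetric_convex_body K"
    and "interior K \<noteq> {}"
    and "lattice_of_rank CARD('n) L"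
    and "lattice_of_rank CARD('n) L1"
    and "L1 \<subset> L"
    and "1 \<le> i" and "i \<le> CARD('n)"
  shows "successive_minimum K (L - L1) i \<le>
           2 ^ CARD('n) * lattice_det L /
             (successive_minimum K L1 1 ^ (CARD('n) - 1) * measure lebesgue K)
           + successive_minimum K L 1 + successive_minimum K L i"
proof -
  interpret symmetric_body K using assms by unfold_locales auto
  have D: "DIM(real ^ 'n) = CARD('n)" by simp
  \<comment> \<open>The same choice as in \<open>lattice_det\<close>, so the determinant is the cell
    volume of \<open>B\<close> by definition.\<close>
  define B where "B = (SOME B. lattice_basis L B)"
  have "\<exists>B. lattice_basis L B" using assms(4) by (auto simp: lattice_of_rank_def)
  then have LB: "lattice_basis L B" unfolding B_def by (rule someI_ex)
  then have B: "independent B" "L = int_span B" by (auto simp: lattice_basis_def)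
  have spB: "span B = UNIV" using lattice_basis_full_rank[of L B] assms(4) LB by simp
  obtain B1 where LB1: "lattice_basis L1 B1" using assms(5) by (auto simp: lattice_of_rank_def)
  then have B1: "independent B1" "L1 = int_span B1" by (auto simp: lattice_basis_def)
  have spB1: "span B1 = UNIV" using lattice_basis_full_rank[of L1 B1] assms(5) LB1 by simp
  have finL: "finite {x \<in> L. N x \<le> t}" for t using finite_sublevel[OF B(1)] B(2) by simp
  have finL1: "finite {x \<in> L1. N x \<le> t}" for t using finite_sublevel[OF B1(1)] B1(2) by simp
  have fin_diff: "finite {x \<in> L - L1. N x \<le> t}" for t
    by (rule finite_subset[OF _ finL[of t]]) auto
  have L_attained: "0 \<le> successive_minimum K L j"
      "j \<le> dim {x \<in> L. N x \<le> successive_minimum K L j}" if j: "j \<le> CARD('n)" for j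
  proof -
    obtain t where "0 \<le> t" "j \<le> dim {x \<in> L. N x \<le> t}"
      using full_rank_sublevel[OF B(1) spB, of j] j B(2) by auto
    from successive_minimum_attained(1,2)[OF finL this]
    show "0 \<le> successive_minimum K L j" "j \<le> dim {x \<in> L. N x \<le> successive_minimum K L j}" .
  qed
  obtain t1 where t1: "0 \<le> t1" "1 \<le> dim {x \<in> L1. N x \<le> t1}"
    using full_rank_sublevel[OF B1(1) spB1, of 1] B1(2) assms(1) by auto
  note L1_attained = successive_minimum_attained[OF finL1 t1]
  define lam where "lam = successive_minimum K L1 1"
  \<comment> \<open>This identifies the first minimum with the norm of a shortest nonzero
    vector.\<close>
  have dim_pos: "1 \<le> dim X \<longleftrightarrow> (\<exists>x\<in>X. x \<noteq> 0)" for X :: "(real ^ 'n) set"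
    using dim_eq_0[of X] by (auto simp: Suc_le_eq simp del: dim_eq_0)
  have lam_le: "lam \<le> N g" if "g \<in> L1" "g \<noteq> 0" for g
    unfolding lam_def using that N_nonneg dim_pos by (intro L1_attained(3)) auto
  have lam_pos: "0 < lam"
  proof -
    obtain x where "x \<noteq> 0" "N x \<le> lam" using L1_attained(2) dim_pos by (auto simp: lam_def)
    then show ?thesis using N_pos[of x] by linarith
  qed
  define t where "t = 2 ^ CARD('n) * lattice_det L / (lam ^ (CARD('n) - 1) * measure lebesgue K)"
  have det: "lattice_det L = measure lebesgue (fundamental_cell B)"
    by (simp add: lattice_det_def B_def)
  have t0: "0 \<le> t" using lam_pos by (simp add: t_def det)
  define M where "M = t + successive_minimum K L 1"
  have "\<exists>a\<in>L - L1. N a \<le> M"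
  proof -
    obtain v where v: "v \<in> L" "v \<noteq> 0" "N v \<le> successive_minimum K L 1"
      using L_attained(2)[of 1] dim_pos assms(1) by auto
    show ?thesis
    proof (cases "v \<in> L1")
      case False
      then show ?thesis using v t0 by (intro bexI[of _ v]) (auto simp: M_def)
    next
      case True
      have "t * lam ^ (CARD('n) - 1) * measure lebesgue K = 2 ^ CARD('n) * lattice_det L"
        using lam_pos measure_K_pos by (simp add: t_def)
      then have "\<exists>a\<in>int_span B - int_span B1. N a \<le> t + lam"
        using short_vector_outside_sublattice[OF B(1) spB _ lam_pos _ t0, of B1]
          lam_le B(2) B1(2) assms(6) det by (simp add: D)
      \<comment> \<open>Here \<open>lam\<close> is at most \<open>N v\<close>, hence at most the
        first minimum of \<open>L\<close>, so \<open>t + lam\<close> is at most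
        \<open>M\<close>.\<close>
      then show ?thesis using lam_le[OF True v(2)] v(3) B(2) B1(2) by (force simp: M_def)
    qed
  qed
  then obtain a where a: "a \<in> L" "a \<notin> L1" "N a \<le> M" by blast
  let ?r = "successive_minimum K L i"
  let ?X = "{x \<in> L - L1. N x \<le> M + ?r}"
  have r0: "0 \<le> ?r" using L_attained(1) assms(8) .
  have M0: "0 \<le> M" using a(3) N_nonneg[of a] by linarith
  have aX: "a \<in> ?X" using a r0 by auto
  \<comment> \<open>Containment in the span already gives the dimension bound, without selecting
    independent vectors: a vector \<open>b\<close> in \<open>L1\<close> is recovered as
    \<open>(a + b) - a\<close>.\<close>
  have "{x \<in> L. N x \<le> ?r} \<subseteq> span ?X"
  proof
    fix b assume b: "b \<in> {x \<in> L. N x \<le> ?r}"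
    show "b \<in> span ?X"
    proof (cases "b \<in> L1")
      case False
      then show ?thesis using b M0 by (intro span_base) auto
    next
      case True
      have "a + b \<notin> L1" using int_span_diff[of "a + b" B1 b] True a B1(2) by auto
      moreover have "a + b \<in> L" using a b B(2) int_span_add by blast
      moreover have "N (a + b) \<le> M + ?r" using N_triangle[of a b] a b by auto
      ultimately have "(a + b) - a \<in> span ?X" using aX by (intro span_diff span_base) auto
      then show ?thesis by simp
    qed
  qed
  then have "i \<le> dim ?X" using dim_mono L_attained(2)[OF assms(8)] order_trans by blast
  then have "successive_minimum K (L - L1) i \<le> M + ?r"
    using M0 r0 by (intro successive_minimum_attained(3)[OF fin_diff, where ?t0.0 = "M + ?r"]) auto
  then show ?thesis by (simp add: M_def t_def lam_def)
qed

end
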